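(* Let $\Vert\cdot\Vert:\mathbb{R}^{m\times n}\to\mathbb{R}$ be a matrix norm. Then its dual continuation $\Vert\cdot\Vert:\mathbb{DR}^{m\times n}\to\mathbb{DR}$ satisfies, for every $\boldsymbol{A}=\boldsymbol{A}_{\rm s}+\boldsymbol{A}_{\rm i}\epsilon\in\mathbb{DR}^{m\times n}$, $$\Vert\boldsymbol{A}\Vert=\begin{cases}\Vert\boldsymbol{A}_{\rm s}\Vert+\max\limits_{\boldsymbol{G}\in\partial\Vert\boldsymbol{A}_{\rm s}\Vert}\langle\boldsymbol{G},\boldsymbol{A}_{\rm i}\rangle\,\epsilon, & \boldsymbol{A}_{\rm s}\ne\boldsymbol{O},\\ \Vert\boldsymbol{A}_{\rm i}\Vert\,\epsilon, & \boldsymbol{A}_{\rm s}=\boldsymbol{O},\end{cases}$$ and it is a dual-valued matrix norm on $\mathbb{DR}^{m\times n}$.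
   Context: Dual numbers: $\mathbb{DR}=\{p_{\rm s}+p_{\rm i}\epsilon: p_{\rm s},p_{\rm i}\in\mathbb{R}\}$ with $\epsilon\neq0$, $\epsilon^2=0$ (a commutative ring). Dual matrices are written $\boldsymbol{A}=\boldsymbol{A}_{\rm s}+\boldsymbol{A}_{\rm i}\epsilon\in\mathbb{DR}^{m\times n}$ with $\boldsymbol{A}_{\rm s},\boldsymbol{A}_{\rm i}\in\mathbb{R}^{m\times n}$. Total order on $\mathbb{DR}$: $p<q$ if $p_{\rm s}<q_{\rm s}$, or $p_{\rm s}=q_{\rm s}$ and $p_{\rm i}<q_{\rm i}$. Absolute value: $|a+b\epsilon|=|a|+\mathrm{sign}(a)b\epsilon$ if $a\ne0$ and $|b\epsilon|=|b|\epsilon$ (the case $a=0$), for $a,b\in\mathbb{R}$. Gâteaux derivative: $\mathcal{D}_u\phi(x)=\lim_{t\downarrow0}\frac{\phi(x+tu)-\phi(x)}{t}$. The dual continuation of a real-valued function $\phi$ on a real space $\mathcal{X}$ is $\tilde\phi(a+b\epsilon)=\phi(a)+\mathcal{D}_b\phi(a)\,\epsilon$ for $a,b\in\mathcal{X}$; the dual continuation of a norm is denoted by the same symbol. "Matrix norm" means a norm on the real vector space $\mathbb{R}^{m\times n}$; $\partial\Vert\boldsymbol{A}_{\rm s}\Vert$ is its (convex) subdifferential at $\boldsymbol{A}_{\rm s}$, and $\langle\boldsymbol{X},\boldsymbol{Y}\rangle=\mathrm{tr}(\boldsymbol{X}^\top\boldsymbol{Y})$. A dual-valued matrix norm on $\mathbb{DR}^{m\times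 n}$ is a function $f:\mathbb{DR}^{m\times n}\to\mathbb{DR}$ such that, under the total order: (i) $f(\boldsymbol{A})\ge0$ for all $\boldsymbol{A}$, and $f(\boldsymbol{A})=0$ iff $\boldsymbol{A}=\boldsymbol{O}$; (ii) $f(a\boldsymbol{A})=|a|f(\boldsymbol{A})$ for all $a\in\mathbb{DR}$; (iii) $f(\boldsymbol{A}+\boldsymbol{B})\le f(\boldsymbol{A})+f(\boldsymbol{B})$ for all $\boldsymbol{A},\boldsymbol{B}$. *)

theory Defs
  imports "HOL-Analysis.Analysis"
begin

text \<open>\<open>Dual a b\<close> stands for \<open>a + b \<epsilon>\<close> with \<open>\<epsilon>\<^sup>2 = 0\<close>.\<close>

datatype dual_number = Dual (std_part: real) (inf_part: real)

lemma dual_number_eq_iff: "p = q \<longleftrightarrow> std_part p = std_part q \<and> inf_part p = inf_part q"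
  by (cases p; cases q) auto

instantiation dual_number :: comm_ring_1
begin

definition "0 = Dual 0 0"
definition "1 = Dual 1 0"
definition "p + q = Dual (std_part p + std_part q) (inf_part p + inf_part q)"
definition "- p = Dual (- std_part p) (- inf_part p)"
definition "p - q = Dual (std_part p - std_part q) (inf_part p - inf_part q)"
definition "p * q =
  Dual (std_part p * std_part q) (std_part p * inf_part q + inf_part p * std_part q)"

instance
  by standard
    (auto simp: dual_number_eq_iff zero_dual_number_def one_dual_number_def plus_dual_number_def
      uminus_dual_number_def minus_dual_number_def times_dual_number_def algebra_simps)

end

instantiation dual_number :: linorder
begin

definition "p < q \<longleftrightarrow>
  std_part p < std_part q \<or> std_part p = std_part q \<and> inf_part p < inf_part q"
definition "p \<le> q \<longleftrightarrow> p < q \<or> (p :: dual_number) = q"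

instance
  by standard (auto simp: less_dual_number_def less_eq_dual_number_def dual_number_eq_iff)

end

instantiation dual_number :: abs
begin

definition "\<bar>p\<bar> =
  (if std_part p \<noteq> 0 then Dual \<bar>std_part p\<bar> (sgn (std_part p) * inf_part p)
   else Dual 0 \<bar>inf_part p\<bar>)"

instance ..

end

definition is_norm :: "('a::real_vector \<Rightarrow> real) \<Rightarrow> bool" where
  "is_norm N \<longleftrightarrow>
     (\<forall>x. 0 \<le> N x) \<and> (\<forall>x. N x = 0 \<longleftrightarrow> x = 0) \<and>
     (\<forall>c x. N (c *\<^sub>R x) = \<bar>c\<bar> * N x) \<and>
     (\<forall>x y. N (x + y) \<le> N x + N y)"

definition mat_inner :: "real^'n^'m \<Rightarrow> real^'n^'m \<Rightarrow> real" where
  "mat_inner X Y = trace (transpose X ** Y)"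

definition subdifferential :: "(real^'n^'m \<Rightarrow> real) \<Rightarrow> real^'n^'m \<Rightarrow> (real^'n^'m) set" where
  "subdifferential f X = {G. \<forall>Y. f X + mat_inner G (Y - X) \<le> f Y}"

definition gateaux_quotient ::
    "('a::real_vector \<Rightarrow> real) \<Rightarrow> 'a \<Rightarrow> 'a \<Rightarrow> real \<Rightarrow> real" where
  "gateaux_quotient \<phi> x u t = (\<phi> (x + t *\<^sub>R u) - \<phi> x) / t"

definition gateaux_differentiable :: "('a::real_vector \<Rightarrow> real) \<Rightarrow> 'a \<Rightarrow> 'a \<Rightarrow> bool" where
  "gateaux_differentiable \<phi> x u \<longleftrightarrow> (\<exists>l. (gateaux_quotient \<phi> x u \<longlongrightarrow> l) (at_right 0))"

text \<open>\<open>Lim\<close> is a definite description, so the value is unspecified unless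
  \<open>gateaux_differentiable \<phi> x u\<close> holds.\<close>

definition gateaux_deriv :: "('a::real_vector \<Rightarrow> real) \<Rightarrow> 'a \<Rightarrow> 'a \<Rightarrow> real" where
  "gateaux_deriv \<phi> x u = Lim (at_right 0) (gateaux_quotient \<phi> x u)"

text \<open>The value at \<open>a + b \<epsilon>\<close> of the dual continuation of \<open>\<phi>\<close>.\<close>

definition dual_continuation ::
    "('a::real_vector \<Rightarrow> real) \<Rightarrow> 'a \<Rightarrow> 'a \<Rightarrow> dual_number" where
  "dual_continuation \<phi> a b = Dual (\<phi> a) (gateaux_deriv \<phi> a b)"

abbreviation std_mat :: "dual_number^'n^'m \<Rightarrow> real^'n^'m" where
  "std_mat A \<equiv> map_matrix std_part A"

abbreviation inf_mat :: "dual_number^'n^'m \<Rightarrow> real^'n^'m" where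
  "inf_mat A \<equiv> map_matrix inf_part A"

definition dual_mat_continuation ::
    "(real^'n^'m \<Rightarrow> real) \<Rightarrow> dual_number^'n^'m \<Rightarrow> dual_number" where
  "dual_mat_continuation \<phi> A = dual_continuation \<phi> (std_mat A) (inf_mat A)"

definition dual_valued_matrix_norm :: "(dual_number^'n^'m \<Rightarrow> dual_number) \<Rightarrow> bool" where
  "dual_valued_matrix_norm f \<longleftrightarrow>
     (\<forall>A. 0 \<le> f A) \<and> (\<forall>A. f A = 0 \<longleftrightarrow> A = 0) \<and>
     (\<forall>a A. f (map_matrix (\<lambda>x. a * x) A) = \<bar>a\<bar> * f A) \<and>
     (\<forall>A B. f (A + B) \<le> f A + f B)"

end

theory Submission
  imports Defs
begin

text \<open>
  A norm \<open>N\<close> is convex, so the difference quotient \<open>(N (x + t u) - N x) / t\<close> is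
  nondecreasing in \<open>t > 0\<close>; by the triangle inequality it never drops below \<open>- N u\<close>. Hence it converges to
  its infimum, the one-sided derivative \<open>N'(x; u)\<close>.

  As a function of the direction \<open>u\<close>, this derivative is sublinear, and it is dominated by the
  increment \<open>N (x + u) - N x\<close>. A linear functional lies below \<open>N'(x; \<cdot>)\<close> exactly when it is a
  subgradient of \<open>N\<close> at \<open>x\<close>. The Hahn-Banach property of sublinear functions (here a
  separation argument for the epigraph, \<open>sublinear_has_exact_minorant\<close>) provides, for each \<open>u\<close>, such
  a functional that agrees with \<open>N'(x; \<cdot>)\<close> at \<open>u\<close>. This is the max formula
  \<open>gateaux_deriv_max_formula\<close>.

  The norm axioms of the dual continuation come from calculus rules for \<open>N'\<close>. The triangle
  inequality needs a look at the infinitesimal parts only if the standard parts satisfy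
  \<open>N (x + y) = N x + N y\<close>, and then the difference quotients themselves are subadditive.
  Homogeneity for a scalar \<open>p + q \<epsilon>\<close> with \<open>p \<noteq> 0\<close> amounts to
  \<open>N'(p x; p u + q x) = \<bar>p\<bar> (N'(x; u) + (q / p) N x)\<close>: the factor \<open>p\<close> can be pulled out of
  the quotients, and the derivative is additive in directions that are multiples of \<open>x\<close>, because
  there it is linear and sublinearity becomes an equality.
\<close>

section \<open>Sublinear functions and linear minorants\<close>

text \<open>
  The point \<open>(u, p u)\<close> lies outside the strict epigraph of \<open>p\<close>, which is convex, so the two can be
  separated by a hyperplane. That hyperplane is not vertical since the epigraph projects onto the
  whole space; its slope \<open>g\<close> makes \<open>p - g\<close> minimal at \<open>u\<close>. Positive homogeneity forces this
  minimum to be \<open>0\<close>.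
\<close>

lemma sublinear_has_exact_minorant:
  fixes p :: "'a::euclidean_space \<Rightarrow> real"
  assumes sub: "\<And>x y. p (x + y) \<le> p x + p y"
    and hom: "\<And>c x. 0 \<le> c \<Longrightarrow> p (c *\<^sub>R x) = c * p x"
  obtains g where "\<And>y. g \<bullet> y \<le> p y" and "g \<bullet> u = p u"
proof -
  define C where "C = {(y, r). p y < r}"
  have "convex C"
    unfolding convex_def C_def
  proof (clarsimp)
    fix x y r s and a b :: real
    assume *: "p x < r" "p y < s" "0 \<le> a" "0 \<le> b" "a + b = 1"
    have "p (a *\<^sub>R x + b *\<^sub>R y) \<le> a * p x + b * p y"
      using sub[of "a *\<^sub>R x" "b *\<^sub>R y"] hom * by simp
    also have "\<dots> < a * r + b * s"
    proof (cases "a = 0")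
      case True
      then show ?thesis using * by simp
    next
      case False
      then have "a * p x < a * r" "b * p y \<le> b * s"
        using * by (auto intro: mult_left_mono)
      then show ?thesis by simp
    qed
    finally show "p (a *\<^sub>R x + b *\<^sub>R y) < a * r + b * s" .
  qed
  moreover have "C \<noteq> {}"
    unfolding C_def using gt_ex[of "p 0"] by auto
  moreover have "{(u, p u)} \<inter> C = {}"
    by (auto simp: C_def)
  ultimately obtain hk b where "hk \<noteq> 0" and
      low: "\<forall>x\<in>{(u, p u)}. hk \<bullet> x \<le> b" and up: "\<forall>x\<in>C. b \<le> hk \<bullet> x"
    using separating_hyperplane_sets[of "{(u, p u)}" C] by auto
  obtain h k where hk: "hk = (h, k)" by (cases hk)
  have sep: "h \<bullet> u + k * p u \<le> h \<bullet> y + k * r" if "p y < r" for y r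
  proof -
    have "hk \<bullet> (u, p u) \<le> hk \<bullet> (y, r)"
      using low up that unfolding C_def by fastforce
    then show ?thesis by (simp add: hk)
  qed
  have "0 \<le> k"
    using sep[of u "p u + 1"] by (simp add: algebra_simps)
  have "k \<noteq> 0"
  proof
    assume "k = 0"
    then have "h \<bullet> u \<le> h \<bullet> (u - h)"
      using sep[of "u - h" "p (u - h) + 1"] by simp
    then have "h \<bullet> h \<le> 0"
      by (simp add: inner_diff_right)
    then have "h = 0"
      by (metis inner_gt_zero_iff not_less)
    then show False
      using \<open>k = 0\<close> \<open>hk \<noteq> 0\<close> by (simp add: hk zero_prod_def)
  qed
  with \<open>0 \<le> k\<close> have "0 < k" by simp
  define g where "g = - (1 / k) *\<^sub>R h"
  have h: "h \<bullet> y = - k * (g \<bullet> y)" for y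
    using \<open>0 < k\<close> by (simp add: g_def)
  have min: "p u - g \<bullet> u \<le> p y - g \<bullet> y" for y
  proof -
    have "p u - g \<bullet> u + g \<bullet> y \<le> r" if "p y < r" for r
    proof -
      have "k * (p u - g \<bullet> u) \<le> k * (r - g \<bullet> y)"
        using sep[OF that] by (simp add: h algebra_simps)
      then show ?thesis using \<open>0 < k\<close> by simp
    qed
    then have "p u - g \<bullet> u + g \<bullet> y \<le> p y"
      by (rule dense_ge)
    then show ?thesis by simp
  qed
  have "p u \<le> g \<bullet> u"
    using min[of 0] hom[of 0 0] by simp
  moreover have "g \<bullet> u \<le> p u"
    using min[of "2 *\<^sub>R u"] hom[of 2 u] by simp
  ultimately have "g \<bullet> u = p u" by simp
  with min that show ?thesis by fastforce
qed

section \<open>One-sided directional derivatives of a norm\<close>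

context
  fixes N :: "'a::real_vector \<Rightarrow> real"
  assumes N: "is_norm N"
begin

lemma norm_nonneg: "0 \<le> N x"
  and norm_eq_zero_iff: "N x = 0 \<longleftrightarrow> x = 0"
  and norm_scale: "N (c *\<^sub>R x) = \<bar>c\<bar> * N x"
  and norm_triangle: "N (x + y) \<le> N x + N y"
  using N by (auto simp: is_norm_def)

text \<open>
  Convexity: \<open>x + s u\<close> lies on the segment from \<open>x\<close> to \<open>x + t u\<close>, at the fraction \<open>s / t\<close> of the way.
\<close>

lemma gateaux_quotient_mono:
  assumes "0 < s" "s \<le> t"
  shows "gateaux_quotient N x u s \<le> gateaux_quotient N x u t"
proof -
  define r where "r = s / t"
  have r: "0 < r" "r \<le> 1" "s = r * t"
    using assms by (auto simp: r_def)
  have "x + s *\<^sub>R u = (1 - r) *\<^sub>R x + r *\<^sub>R (x + t *\<^sub>R u)"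
    by (simp add: r algebra_simps)
  then have "N (x + s *\<^sub>R u) \<le> (1 - r) * N x + r * N (x + t *\<^sub>R u)"
    using norm_triangle[of "(1 - r) *\<^sub>R x" "r *\<^sub>R (x + t *\<^sub>R u)"] r by (simp only: norm_scale)
  then have "N (x + s *\<^sub>R u) - N x \<le> r * (N (x + t *\<^sub>R u) - N x)"
    by (simp add: algebra_simps)
  then have "(N (x + s *\<^sub>R u) - N x) / s \<le> r * (N (x + t *\<^sub>R u) - N x) / s"
    using assms by (intro divide_right_mono) auto
  also have "\<dots> = (N (x + t *\<^sub>R u) - N x) / t"
    using assms by (simp add: r_def)
  finally show ?thesis
    by (simp add: gateaux_quotient_def)
qed

lemma gateaux_quotient_lower_bound:
  assumes "0 < t"
  shows "- N u \<le> gateaux_quotient N x u t"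
proof -
  have "N x \<le> N (x + t *\<^sub>R u) + t * N u"
    using norm_triangle[of "x + t *\<^sub>R u" "(- t) *\<^sub>R u"] assms norm_scale[of "- t" u] by simp
  then show ?thesis
    using assms by (simp add: gateaux_quotient_def field_simps)
qed

lemma gateaux_quotient_tendsto_Inf:
  "(gateaux_quotient N x u \<longlongrightarrow> Inf (gateaux_quotient N x u ` {0<..})) (at_right 0)"
proof (rule order_tendstoI)
  let ?q = "gateaux_quotient N x u"
  have bdd: "bdd_below (?q ` {0<..})"
    by (rule bdd_belowI2[where m = "- N u"]) (use gateaux_quotient_lower_bound in auto)
  fix a
  {
    assume "a < Inf (?q ` {0<..})"
    then have "a < ?q t" if "0 < t" for t
      using cINF_lower[OF bdd, of t] that by simp
    then show "\<forall>\<^sub>F t in at_right 0. a < ?q t"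
      by (auto simp: eventually_at_right_field intro: exI[of _ 1])
  next
    assume "Inf (?q ` {0<..}) < a"
    then obtain t where t: "0 < t" "?q t < a"
      using cINF_less_iff[OF _ bdd, of a] by auto
    then have "?q s < a" if "0 < s" "s < t" for s
      using gateaux_quotient_mono[of s t x u] that by simp
    with t show "\<forall>\<^sub>F s in at_right 0. ?q s < a"
      by (auto simp: eventually_at_right_field)
  }
qed

lemma gateaux_differentiable_norm: "gateaux_differentiable N x u"
  using gateaux_quotient_tendsto_Inf unfolding gateaux_differentiable_def by blast

lemma gateaux_quotient_tendsto_deriv:
  "(gateaux_quotient N x u \<longlongrightarrow> gateaux_deriv N x u) (at_right 0)"
  unfolding gateaux_deriv_def
  by (metis gateaux_quotient_tendsto_Inf tendsto_Lim trivial_limit_at_right_real)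

lemma gateaux_deriv_eqI:
  assumes "\<And>t. 0 < t \<Longrightarrow> t < d \<Longrightarrow> gateaux_quotient N x u t = l" "0 < d"
  shows "gateaux_deriv N x u = l"
proof -
  have "\<forall>\<^sub>F t in at_right 0. gateaux_quotient N x u t = l"
    using assms by (auto simp: eventually_at_right_field)
  then have "(gateaux_quotient N x u \<longlongrightarrow> l) (at_right 0)"
    by (rule tendsto_eventually)
  then show ?thesis
    using gateaux_quotient_tendsto_deriv tendsto_unique trivial_limit_at_right_real by blast
qed

text \<open>By monotonicity the limit lies below the quotient at \<open>t = 1\<close>.\<close>

lemma gateaux_deriv_le_increment: "gateaux_deriv N x u \<le> N (x + u) - N x"
proof (rule tendsto_upperbound[OF gateaux_quotient_tendsto_deriv])
  show "\<forall>\<^sub>F t in at_right 0. gateaux_quotient N x u t \<le> N (x + u) - N x"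
    unfolding eventually_at_right_field
    using gateaux_quotient_mono[of _ 1 x u] by (intro exI[of _ 1]) (simp add: gateaux_quotient_def)
qed simp

lemma gateaux_deriv_at_zero: "gateaux_deriv N 0 u = N u"
  using norm_eq_zero_iff[of 0]
  by (intro gateaux_deriv_eqI[of 1]) (simp_all add: gateaux_quotient_def norm_scale)

text \<open>
  On the ray through \<open>x\<close> the norm is linear as long as \<open>1 + t c\<close> stays nonnegative, which holds
  for all small \<open>t\<close>.
\<close>

lemma gateaux_deriv_radial: "gateaux_deriv N x (c *\<^sub>R x) = c * N x"
proof (rule gateaux_deriv_eqI)
  fix t :: real
  assume t: "0 < t" "t < 1 / (\<bar>c\<bar> + 1)"
  then have "t * \<bar>c\<bar> + t < 1"
    by (simp add: field_simps add_pos_nonneg)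
  moreover have "\<bar>t * c\<bar> = t * \<bar>c\<bar>"
    using t by (simp add: abs_mult)
  ultimately have "0 \<le> 1 + t * c"
    using t by linarith
  moreover have "x + t *\<^sub>R c *\<^sub>R x = (1 + t * c) *\<^sub>R x"
    by (simp add: algebra_simps)
  ultimately have "N (x + t *\<^sub>R c *\<^sub>R x) = (1 + t * c) * N x"
    by (simp only: norm_scale)
  then show "gateaux_quotient N x (c *\<^sub>R x) t = c * N x"
    using t by (simp add: gateaux_quotient_def algebra_simps)
qed (simp add: add_nonneg_pos)

lemma gateaux_deriv_scale_both:
  "gateaux_deriv N (c *\<^sub>R x) (c *\<^sub>R u) = \<bar>c\<bar> * gateaux_deriv N x u"
proof -
  have "c *\<^sub>R x + t *\<^sub>R c *\<^sub>R u = c *\<^sub>R (x + t *\<^sub>R u)" for t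
    by (simp add: algebra_simps)
  then have "gateaux_quotient N (c *\<^sub>R x) (c *\<^sub>R u) = (\<lambda>t. \<bar>c\<bar> * gateaux_quotient N x u t)"
    by (simp only: fun_eq_iff gateaux_quotient_def norm_scale) (simp add: algebra_simps)
  then have "((\<lambda>t. \<bar>c\<bar> * gateaux_quotient N x u t) \<longlongrightarrow> gateaux_deriv N (c *\<^sub>R x) (c *\<^sub>R u)) (at_right 0)"
    using gateaux_quotient_tendsto_deriv[of "c *\<^sub>R x" "c *\<^sub>R u"] by simp
  moreover have "((\<lambda>t. \<bar>c\<bar> * gateaux_quotient N x u t) \<longlongrightarrow> \<bar>c\<bar> * gateaux_deriv N x u) (at_right 0)"
    by (intro tendsto_mult_left gateaux_quotient_tendsto_deriv)
  ultimately show ?thesis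
    using tendsto_unique trivial_limit_at_right_real by blast
qed

text \<open>Rescaling the direction amounts to the substitution \<open>t \<mapsto> c t\<close>, which preserves \<open>t \<down> 0\<close>.\<close>

lemma gateaux_deriv_pos_homogeneous:
  assumes "0 \<le> c"
  shows "gateaux_deriv N x (c *\<^sub>R u) = c * gateaux_deriv N x u"
proof (cases "c = 0")
  case True
  then show ?thesis
    using gateaux_deriv_radial[of x 0] by simp
next
  case False
  with assms have "0 < c" by simp
  have "filterlim (\<lambda>t. c * t) (at_right 0) (at_right (0::real))"
    unfolding filterlim_at
    using \<open>0 < c\<close> by (auto simp: eventually_at_right_field intro!: tendsto_eq_intros exI[of _ 1])
  from filterlim_compose[OF gateaux_quotient_tendsto_deriv this]
  have "((\<lambda>t. c * gateaux_quotient N x u (c * t)) \<longlongrightarrow> c * gateaux_deriv N x u) (at_right 0)"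
    by (intro tendsto_mult_left)
  moreover have "(\<lambda>t. c * gateaux_quotient N x u (c * t)) = gateaux_quotient N x (c *\<^sub>R u)"
    using \<open>0 < c\<close> by (simp add: fun_eq_iff gateaux_quotient_def mult.commute)
  ultimately show ?thesis
    using gateaux_quotient_tendsto_deriv tendsto_unique trivial_limit_at_right_real by metis
qed

text \<open>
  Where the triangle inequality is tight at the base points, it passes to the difference quotients.
\<close>

lemma gateaux_deriv_add_le:
  assumes "N (x + y) = N x + N y"
  shows "gateaux_deriv N (x + y) (u + v) \<le> gateaux_deriv N x u + gateaux_deriv N y v"
proof (rule tendsto_le)
  show "(gateaux_quotient N (x + y) (u + v) \<longlongrightarrow> gateaux_deriv N (x + y) (u + v)) (at_right 0)"
    by (rule gateaux_quotient_tendsto_deriv)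
  show "((\<lambda>t. gateaux_quotient N x u t + gateaux_quotient N y v t)
      \<longlongrightarrow> gateaux_deriv N x u + gateaux_deriv N y v) (at_right 0)"
    by (intro tendsto_add gateaux_quotient_tendsto_deriv)
  have "gateaux_quotient N (x + y) (u + v) t \<le> gateaux_quotient N x u t + gateaux_quotient N y v t"
    if "0 < t" for t
  proof -
    have "x + y + t *\<^sub>R (u + v) = (x + t *\<^sub>R u) + (y + t *\<^sub>R v)"
      by (simp add: algebra_simps)
    then have "N (x + y + t *\<^sub>R (u + v)) \<le> N (x + t *\<^sub>R u) + N (y + t *\<^sub>R v)"
      using norm_triangle by metis
    then have "N (x + y + t *\<^sub>R (u + v)) - N (x + y)
        \<le> (N (x + t *\<^sub>R u) - N x) + (N (y + t *\<^sub>R v) - N y)"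
      using assms by simp
    then have "(N (x + y + t *\<^sub>R (u + v)) - N (x + y)) / t
        \<le> ((N (x + t *\<^sub>R u) - N x) + (N (y + t *\<^sub>R v) - N y)) / t"
      using that by (intro divide_right_mono) auto
    then show ?thesis
      by (simp only: gateaux_quotient_def add_divide_distrib)
  qed
  then show "\<forall>\<^sub>F t in at_right 0. gateaux_quotient N (x + y) (u + v) t
      \<le> gateaux_quotient N x u t + gateaux_quotient N y v t"
    by (auto simp: eventually_at_right_field intro: exI[of _ 1])
qed simp

text \<open>
  The tight case of the triangle inequality with both base points equal to \<open>x / 2\<close>; halving
  the base point does not change the derivative, which is homogeneous of degree \<open>0\<close> there.
\<close>

lemma gateaux_deriv_subadditive:
  "gateaux_deriv N x (u + v) \<le> gateaux_deriv N x u + gateaux_deriv N x v"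
proof -
  have half: "gateaux_deriv N ((1/2) *\<^sub>R x) w = gateaux_deriv N x w" for w
    using gateaux_deriv_scale_both[of "1/2" x "2 *\<^sub>R w"] gateaux_deriv_pos_homogeneous[of 2 x w]
    by simp
  have x: "(1/2) *\<^sub>R x + (1/2) *\<^sub>R x = x"
    by (simp flip: scaleR_add_left)
  have "N ((1/2) *\<^sub>R x + (1/2) *\<^sub>R x) = N ((1/2) *\<^sub>R x) + N ((1/2) *\<^sub>R x)"
    by (simp only: x norm_scale)
  from gateaux_deriv_add_le[OF this, of u v] show ?thesis
    by (simp only: half x)
qed

text \<open>
  Subadditivity gives \<open>\<le>\<close>; applied to \<open>u = (u + c x) + (- c) x\<close> it gives \<open>\<ge>\<close>, because
  the derivatives in the directions \<open>c x\<close> and \<open>- c x\<close> cancel.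
\<close>

lemma gateaux_deriv_add_radial:
  "gateaux_deriv N x (u + c *\<^sub>R x) = gateaux_deriv N x u + c * N x"
  using gateaux_deriv_subadditive[of x u "c *\<^sub>R x"]
    gateaux_deriv_subadditive[of x "u + c *\<^sub>R x" "(- c) *\<^sub>R x"]
    gateaux_deriv_radial[of x c] gateaux_deriv_radial[of x "- c"]
  by simp

end

section \<open>The max formula\<close>

lemma mat_inner_eq_inner: "mat_inner X Y = X \<bullet> Y"
proof -
  have "mat_inner X Y = (\<Sum>j\<in>UNIV. \<Sum>i\<in>UNIV. X $ i $ j * Y $ i $ j)"
    by (simp add: mat_inner_def trace_def matrix_matrix_mult_def transpose_def)
  also have "\<dots> = (\<Sum>i\<in>UNIV. \<Sum>j\<in>UNIV. X $ i $ j * Y $ i $ j)"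
    by (rule sum.swap)
  finally show ?thesis
    by (simp add: inner_vec_def)
qed

text \<open>
  The subgradient inequality along the ray \<open>X + t U\<close> says that \<open>\<langle>G, U\<rangle>\<close> lies below all
  difference quotients.
\<close>

lemma subgradient_le_gateaux_deriv:
  fixes N :: "real^'n^'m \<Rightarrow> real"
  assumes "is_norm N" "G \<in> subdifferential N X"
  shows "mat_inner G U \<le> gateaux_deriv N X U"
proof (rule tendsto_lowerbound[OF gateaux_quotient_tendsto_deriv[OF assms(1)]])
  have "mat_inner G U \<le> gateaux_quotient N X U t" if "0 < t" for t
  proof -
    have "N X + mat_inner G (X + t *\<^sub>R U - X) \<le> N (X + t *\<^sub>R U)"
      using assms(2) unfolding subdifferential_def by blast
    then show ?thesis
      using that by (simp add: mat_inner_eq_inner gateaux_quotient_def field_simps)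
  qed
  then show "\<forall>\<^sub>F t in at_right 0. mat_inner G U \<le> gateaux_quotient N X U t"
    by (auto simp: eventually_at_right_field intro: exI[of _ 1])
qed simp

text \<open>
  A linear minorant of \<open>N'(X; \<cdot>)\<close> is a subgradient, since \<open>N'(X; Y - X) \<le> N Y - N X\<close>.
\<close>

lemma gateaux_deriv_max_formula:
  fixes N :: "real^'n^'m \<Rightarrow> real"
  assumes N: "is_norm N"
  obtains G where "is_arg_max (\<lambda>G. mat_inner G U) (\<lambda>G. G \<in> subdifferential N X) G"
    and "gateaux_deriv N X U = mat_inner G U"
proof -
  obtain G where G: "\<And>Y. G \<bullet> Y \<le> gateaux_deriv N X Y" "G \<bullet> U = gateaux_deriv N X U"
    using sublinear_has_exact_minorant[of "gateaux_deriv N X" U]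
      gateaux_deriv_subadditive[OF N] gateaux_deriv_pos_homogeneous[OF N] by blast
  have "N X + G \<bullet> (Y - X) \<le> N Y" for Y
    using G(1)[of "Y - X"] gateaux_deriv_le_increment[OF N, of X "Y - X"] by simp
  then have "G \<in> subdifferential N X"
    by (simp add: subdifferential_def mat_inner_eq_inner)
  moreover have "mat_inner H U \<le> mat_inner G U" if "H \<in> subdifferential N X" for H
    using subgradient_le_gateaux_deriv[OF N that, of U] G(2) by (simp add: mat_inner_eq_inner)
  ultimately have "is_arg_max (\<lambda>G. mat_inner G U) (\<lambda>G. G \<in> subdifferential N X) G"
    by (auto simp: is_arg_max_linorder)
  with G(2) that show ?thesis
    by (simp add: mat_inner_eq_inner)
qed

section \<open>The dual continuation is a dual-valued norm\<close>

lemma std_mat_add: "std_mat (A + B) = std_mat A + std_mat B"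
  and inf_mat_add: "inf_mat (A + B) = inf_mat A + inf_mat B"
  by (simp_all add: vec_eq_iff map_matrix_def plus_dual_number_def)

lemma std_mat_scale: "std_mat (map_matrix (\<lambda>x. a * x) A) = std_part a *\<^sub>R std_mat A"
  and inf_mat_scale: "inf_mat (map_matrix (\<lambda>x. a * x) A)
    = std_part a *\<^sub>R inf_mat A + inf_part a *\<^sub>R std_mat A"
  by (simp_all add: vec_eq_iff map_matrix_def times_dual_number_def)

lemma dual_mat_eq_0_iff: "A = 0 \<longleftrightarrow> std_mat A = 0 \<and> inf_mat A = 0"
  by (auto simp: vec_eq_iff map_matrix_def zero_dual_number_def dual_number_eq_iff)

lemma dual_mat_continuation_at_infinitesimal:
  assumes "is_norm N" "std_mat A = 0"
  shows "dual_mat_continuation N A = Dual 0 (N (inf_mat A))"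
  using assms
  by (simp add: dual_mat_continuation_def dual_continuation_def gateaux_deriv_at_zero norm_eq_zero_iff)

lemma dual_mat_continuation_pos_or_zero:
  assumes N: "is_norm N"
  shows "0 \<le> dual_mat_continuation N A \<and> (dual_mat_continuation N A = 0 \<longleftrightarrow> A = 0)"
proof (cases "std_mat A = 0")
  case True
  then show ?thesis
    using norm_nonneg[OF N, of "inf_mat A"] norm_eq_zero_iff[OF N, of "inf_mat A"]
      dual_mat_continuation_at_infinitesimal[OF N True]
    by (auto simp: dual_mat_eq_0_iff less_eq_dual_number_def less_dual_number_def
        zero_dual_number_def)
next
  case False
  then have "0 < N (std_mat A)"
    using norm_nonneg[OF N, of "std_mat A"] norm_eq_zero_iff[OF N, of "std_mat A"] by linarith
  with False show ?thesis
    by (auto simp: dual_mat_eq_0_iff less_eq_dual_number_def less_dual_number_def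
        zero_dual_number_def dual_mat_continuation_def dual_continuation_def)
qed

text \<open>
  If the standard part \<open>p\<close> of the scalar vanishes, then \<open>\<epsilon>\<^sup>2 = 0\<close> removes the derivative on both
  sides; otherwise \<open>p U + q X = p (U + (q / p) X)\<close> reduces the claim to the calculus rules.
\<close>

lemma dual_mat_continuation_scale:
  assumes N: "is_norm N"
  shows "dual_mat_continuation N (map_matrix (\<lambda>x. a * x) A) = \<bar>a\<bar> * dual_mat_continuation N A"
proof -
  define p q X U where defs: "p = std_part a" "q = inf_part a" "X = std_mat A" "U = inf_mat A"
  have lhs: "dual_mat_continuation N (map_matrix (\<lambda>x. a * x) A)
      = Dual (N (p *\<^sub>R X)) (gateaux_deriv N (p *\<^sub>R X) (p *\<^sub>R U + q *\<^sub>R X))"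
    by (simp add: dual_mat_continuation_def dual_continuation_def std_mat_scale inf_mat_scale defs)
  have rhs: "dual_mat_continuation N A = Dual (N X) (gateaux_deriv N X U)"
    by (simp add: dual_mat_continuation_def dual_continuation_def defs)
  show ?thesis
  proof (cases "p = 0")
    case True
    then show ?thesis
      unfolding lhs rhs
      by (simp add: gateaux_deriv_at_zero[OF N] norm_scale[OF N] norm_eq_zero_iff[OF N]
          abs_dual_number_def times_dual_number_def flip: defs)
  next
    case False
    then have "p *\<^sub>R U + q *\<^sub>R X = p *\<^sub>R (U + (q / p) *\<^sub>R X)"
      by (simp add: scaleR_add_right)
    then have "gateaux_deriv N (p *\<^sub>R X) (p *\<^sub>R U + q *\<^sub>R X)
        = \<bar>p\<bar> * (gateaux_deriv N X U + (q / p) * N X)"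
      by (simp only: gateaux_deriv_scale_both[OF N] gateaux_deriv_add_radial[OF N])
    also have "\<dots> = \<bar>p\<bar> * gateaux_deriv N X U + sgn p * q * N X"
      using False by (auto simp: sgn_if field_simps)
    finally show ?thesis
      unfolding lhs rhs
      using False
      by (simp add: norm_scale[OF N] abs_dual_number_def times_dual_number_def flip: defs)
  qed
qed

lemma dual_mat_continuation_triangle:
  assumes N: "is_norm N"
  shows "dual_mat_continuation N (A + B) \<le> dual_mat_continuation N A + dual_mat_continuation N B"
proof -
  consider "N (std_mat A + std_mat B) < N (std_mat A) + N (std_mat B)"
    | "N (std_mat A + std_mat B) = N (std_mat A) + N (std_mat B)"
    using norm_triangle[OF N, of "std_mat A" "std_mat B"] by linarith
  then show ?thesis
  proof cases
    case 1
    then show ?thesis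
      by (simp add: dual_mat_continuation_def dual_continuation_def std_mat_add inf_mat_add
          less_eq_dual_number_def less_dual_number_def plus_dual_number_def)
  next
    case 2
    from gateaux_deriv_add_le[OF N this, of "inf_mat A" "inf_mat B"] 2 show ?thesis
      by (auto simp: dual_mat_continuation_def dual_continuation_def std_mat_add inf_mat_add
          less_eq_dual_number_def less_dual_number_def plus_dual_number_def)
  qed
qed

theorem theorem5p2:
  fixes N :: "real^'n^'m \<Rightarrow> real"
  assumes "is_norm N"
  shows "(\<forall>X U. gateaux_differentiable N X U) \<and>
    (\<forall>A :: dual_number^'n^'m.
      (std_mat A \<noteq> 0 \<longrightarrow>
        (\<exists>G. is_arg_max (\<lambda>G. mat_inner G (inf_mat A)) (\<lambda>G. G \<in> subdifferential N (std_mat A)) G \<and>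
             dual_mat_continuation N A = Dual (N (std_mat A)) (mat_inner G (inf_mat A)))) \<and>
      (std_mat A = 0 \<longrightarrow> dual_mat_continuation N A = Dual 0 (N (inf_mat A)))) \<and>
    dual_valued_matrix_norm (dual_mat_continuation N)"
proof (intro conjI allI impI)
  show "gateaux_differentiable N X U" for X U
    by (rule gateaux_differentiable_norm[OF assms])
  show "\<exists>G. is_arg_max (\<lambda>G. mat_inner G (inf_mat A)) (\<lambda>G. G \<in> subdifferential N (std_mat A)) G \<and>
      dual_mat_continuation N A = Dual (N (std_mat A)) (mat_inner G (inf_mat A))"
    for A :: "dual_number^'n^'m"
    using gateaux_deriv_max_formula[OF assms, of "inf_mat A" "std_mat A"]
    by (auto simp: dual_mat_continuation_def dual_continuation_def)
  show "dual_mat_continuation N A = Dual 0 (N (inf_mat A))"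
    if "std_mat A = 0" for A :: "dual_number^'n^'m"
    by (rule dual_mat_continuation_at_infinitesimal[OF assms that])
  show "dual_valued_matrix_norm (dual_mat_continuation N)"
    unfolding dual_valued_matrix_norm_def
    using dual_mat_continuation_pos_or_zero[OF assms] dual_mat_continuation_scale[OF assms]
      dual_mat_continuation_triangle[OF assms] by blast
qed

end
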